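(* Let $I_0$ be the modified Bessel function of the first kind of order $0$. Then for all real $t\ge 0$, $$I_0(t)^2\le \frac{2\exp\left(\sqrt{1+4t^2}-1\right)}{\sqrt{1+4t^2}+1}.$$
   Context: The modified Bessel function of the first kind of order $0$ is $I_0(t)=\sum_{k=0}^\infty \frac{(t/2)^{2k}}{(k!)^2}$. *)

theory Defs
  imports "HOL-Analysis.Analysis"
begin

definition bessel_I0 :: "real \<Rightarrow> real" where
  "bessel_I0 t = (\<Sum>k. (t / 2) ^ (2 * k) / (fact k)\<^sup>2)"

(* The series converges for every real t, so suminf denotes its genuine sum. *)
lemma bessel_I0_sums:
  "(\<lambda>k. (t / 2) ^ (2 * k) / (fact k)\<^sup>2) sums bessel_I0 t"
proof -
  have "summable (\<lambda>k. (t / 2) ^ (2 * k) / (fact k)\<^sup>2)"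
  proof (rule summable_comparison_test')
    show "summable (\<lambda>k. inverse (fact k) * ((t / 2)\<^sup>2) ^ k)"
      by (rule summable_exp)
    fix k :: nat
    have "(t / 2) ^ (2 * k) / (fact k)\<^sup>2 \<le> (t / 2) ^ (2 * k) / fact k"
      by (rule divide_left_mono) (auto simp: power2_eq_square fact_ge_1)
    moreover have "0 \<le> (t / 2) ^ (2 * k) / (fact k)\<^sup>2"
      by (simp add: zero_le_even_power)
    moreover have "(t / 2) ^ (2 * k) / fact k = inverse (fact k) * ((t / 2)\<^sup>2) ^ k"
      unfolding power_mult by (simp only: divide_inverse[of _ "fact k"] mult.commute)
    ultimately show "norm ((t / 2) ^ (2 * k) / (fact k)\<^sup>2) \<le> inverse (fact k) * ((t / 2)\<^sup>2) ^ k"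
      by (simp only: real_norm_def abs_of_nonneg)
  qed
  then show ?thesis
    unfolding bessel_I0_def by (rule summable_sums)
qed

end

theory Submission
  imports Defs
begin

text \<open>
  Write \<open>I\<^sub>0 t = g (t\<^sup>2 / 4)\<close> with \<open>g x = (\<Sum>k. x ^ k / (k!)\<^sup>2)\<close>, and let \<open>p x = x * g' x\<close>; Bessel's
  equation becomes \<open>p' = g\<close>. Then \<open>(x g\<^sup>2 - p\<^sup>2)' = g\<^sup>2 \<ge> 0\<close>, so \<open>p\<^sup>2 \<le> x g\<^sup>2\<close>, and therefore
  \<open>(2 x g\<^sup>2 - 2 p\<^sup>2 - p g)' = g\<^sup>2 - p\<^sup>2 / x \<ge> 0\<close>. Solving the quadratic inequality
  \<open>2 p\<^sup>2 + p g \<le> 2 x g\<^sup>2\<close> for \<open>p / g\<close> bounds the logarithmic derivative \<open>g' / g\<close> by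
  \<open>4 / (sqrt (1 + 16 x) + 1)\<close>, which is half of the logarithmic derivative of the right-hand side.
\<close>

definition bessel_gen :: "real \<Rightarrow> real" where
  "bessel_gen x = (\<Sum>k. (1 / (fact k)\<^sup>2) * x ^ k)"

definition bessel_gen_deriv :: "real \<Rightarrow> real" where
  "bessel_gen_deriv x = (\<Sum>k. (1 / (fact k * fact (Suc k))) * x ^ k)"

lemma bessel_I0_eq_bessel_gen: "bessel_I0 t = bessel_gen (t\<^sup>2 / 4)"
  unfolding bessel_I0_def bessel_gen_def
  by (rule arg_cong[where f = suminf]) (simp add: power_mult power_divide fun_eq_iff)

text \<open>Domination by the exponential series at \<open>\<bar>x\<bar>\<close>; convergence at
  every real \<open>x\<close> is what later allows termwise differentiation everywhere.\<close>

lemma summable_le_inverse_fact: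
  fixes a :: "nat \<Rightarrow> real"
  assumes "\<And>k. \<bar>a k\<bar> \<le> inverse (fact k)"
  shows "summable (\<lambda>k. a k * x ^ k)"
proof (rule summable_comparison_test')
  show "summable (\<lambda>k. inverse (fact k) * \<bar>x\<bar> ^ k)"
    by (rule summable_exp)
  show "norm (a k * x ^ k) \<le> inverse (fact k) * \<bar>x\<bar> ^ k" for k
    using assms[of k] by (simp add: abs_mult power_abs mult_right_mono)
qed

lemma summable_bessel_gen: "summable (\<lambda>k. (1 / (fact k)\<^sup>2) * (x::real) ^ k)"
  by (rule summable_le_inverse_fact)
    (simp add: power2_eq_square divide_simps)

lemma summable_bessel_gen_deriv:
  "summable (\<lambda>k. (1 / (fact k * fact (Suc k))) * (x::real) ^ k)"
  by (rule summable_le_inverse_fact)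
    (simp add: divide_simps abs_mult del: fact_Suc)

lemma bessel_gen_has_derivative:
  "(bessel_gen has_real_derivative bessel_gen_deriv x) (at x)"
proof -
  have "diffs (\<lambda>k. 1 / (fact k)\<^sup>2) = (\<lambda>k. 1 / (fact k * fact (Suc k)) :: real)"
    by (simp add: diffs_def fun_eq_iff power2_eq_square divide_simps)
  then show ?thesis
    using termdiffs_strong_converges_everywhere[OF summable_bessel_gen, of x]
    unfolding bessel_gen_def bessel_gen_deriv_def by (simp del: fact_Suc)
qed

text \<open>Multiplying the derivative series by x gives coefficients k / (k!)^2; differentiating
  again gives (k+1)^2 / ((k+1)!)^2 = 1 / (k!)^2, the original coefficients.\<close>

lemma bessel_gen_Euler_has_derivative:
  "((\<lambda>x. x * bessel_gen_deriv x) has_real_derivative bessel_gen x) (at x)"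
proof -
  define a :: "nat \<Rightarrow> real" where "a = (\<lambda>k. of_nat k / (fact k)\<^sup>2)"
  have Suc: "a (Suc k) = 1 / (fact k * fact (Suc k))" for k
    by (simp add: a_def power2_eq_square divide_simps)
  have sums: "(\<lambda>k. a k * y ^ k) sums (y * bessel_gen_deriv y)" for y
  proof -
    have "(\<lambda>k. a (Suc k) * y ^ Suc k) sums (y * bessel_gen_deriv y)"
      using sums_mult[OF summable_sums[OF summable_bessel_gen_deriv, of y], of y]
      unfolding bessel_gen_deriv_def Suc by (simp add: ac_simps del: fact_Suc)
    \<comment> \<open>The index shift adds only the term for k = 0, and
      \<open>a 0 = 0\<close>.\<close>
    then show ?thesis
      by (subst (asm) sums_Suc_iff) (simp add: a_def)
  qed
  have "diffs a = (\<lambda>k. 1 / (fact k)\<^sup>2)"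
    by (simp add: diffs_def Suc fun_eq_iff power2_eq_square divide_simps)
  then have "((\<lambda>y. \<Sum>k. a k * y ^ k) has_real_derivative bessel_gen x) (at x)"
    using termdiffs_strong_converges_everywhere[of a x] sums
    unfolding bessel_gen_def by (auto simp: sums_iff)
  then show ?thesis
    using sums by (simp add: sums_iff)
qed

lemma bessel_gen_ge_1:
  assumes "x \<ge> 0"
  shows "bessel_gen x \<ge> 1"
  using sum_le_suminf[OF summable_bessel_gen, of "{0}" x] assms
  by (simp add: bessel_gen_def)

lemma bessel_gen_0: "bessel_gen 0 = 1"
  unfolding bessel_gen_def by (subst powser_zero) simp

lemma Euler_square_le:
  assumes "x \<ge> 0"
  shows "(x * bessel_gen_deriv x)\<^sup>2 \<le> x * (bessel_gen x)\<^sup>2"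
proof -
  define p where "p = (\<lambda>x. x * bessel_gen_deriv x)"
  have p: "(p has_real_derivative bessel_gen y) (at y)" for y
    unfolding p_def by (rule bessel_gen_Euler_has_derivative)
  let ?K = "\<lambda>x. x * (bessel_gen x)\<^sup>2 - (p x)\<^sup>2"
  have "?K 0 \<le> ?K x"
  proof (rule DERIV_nonneg_imp_nondecreasing[OF assms])
    fix y
    \<comment> \<open>The terms 2 y g g' and -2 p g cancel since p = y g'.\<close>
    have "(?K has_real_derivative (bessel_gen y)\<^sup>2) (at y)"
      by (rule bessel_gen_has_derivative p derivative_eq_intros refl)+
        (simp add: p_def power2_eq_square algebra_simps)
    then show "\<exists>D. (?K has_real_derivative D) (at y) \<and> 0 \<le> D"
      by auto
  qed
  then show ?thesis
    by (simp add: p_def)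
qed

lemma Euler_quadratic_le:
  assumes "x \<ge> 0"
  shows "2 * (x * bessel_gen_deriv x)\<^sup>2 + (x * bessel_gen_deriv x) * bessel_gen x
    \<le> 2 * x * (bessel_gen x)\<^sup>2"
proof -
  define p where "p = (\<lambda>x. x * bessel_gen_deriv x)"
  have p: "(p has_real_derivative bessel_gen y) (at y)" for y
    unfolding p_def by (rule bessel_gen_Euler_has_derivative)
  let ?H = "\<lambda>x. 2 * x * (bessel_gen x)\<^sup>2 - 2 * (p x)\<^sup>2
    - p x * bessel_gen x"
  have "?H 0 \<le> ?H x"
  \<comment> \<open>Only interior points need a sign check, so the bound on p^2 may be divided by
    \<open>y > 0\<close>.\<close>
  proof (rule DERIV_nonneg_imp_increasing_open[OF assms])
    \<comment> \<open>Here 4 y g g' cancels against 4 p g, and (p g)' = g^2 + y g'^2.\<close>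
    have deriv: "(?H has_real_derivative
        (bessel_gen y)\<^sup>2 - y * (bessel_gen_deriv y)\<^sup>2) (at y)" for y
      by (rule bessel_gen_has_derivative p derivative_eq_intros refl)+
        (simp add: p_def power2_eq_square algebra_simps)
    then show "continuous_on {0..x} ?H"
      by (meson DERIV_isCont continuous_at_imp_continuous_on)
    fix y :: real
    assume "0 < y" "y < x"
    then have "y * (y * (bessel_gen_deriv y)\<^sup>2) \<le> y * (bessel_gen y)\<^sup>2"
      using Euler_square_le[of y] by (simp add: power2_eq_square ac_simps)
    then have "y * (bessel_gen_deriv y)\<^sup>2 \<le> (bessel_gen y)\<^sup>2"
      using \<open>0 < y\<close> by simp
    then show "\<exists>D. (?H has_real_derivative D) (at y) \<and> 0 \<le> D"
      using deriv by (intro exI conjI) auto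
  qed
  then show ?thesis
    by (simp add: p_def)
qed

lemma bessel_gen_deriv_le:
  assumes "x > 0"
  shows "bessel_gen_deriv x / bessel_gen x \<le> 4 / (sqrt (1 + 16 * x) + 1)"
proof -
  define s where "s = sqrt (1 + 16 * x)"
  define y where "y = x * bessel_gen_deriv x / bessel_gen x"
  have s: "s\<^sup>2 = 1 + 16 * x" "s > 1"
    using assms by (auto simp: s_def)
  have g: "bessel_gen x > 0"
    using bessel_gen_ge_1[of x] assms by simp
  have "2 * y\<^sup>2 + y \<le> 2 * x"
    using Euler_quadratic_le[of x] assms g
    by (simp add: y_def divide_simps power2_eq_square algebra_simps)
  \<comment> \<open>Completing the square: multiply by 8 and add 1.\<close>
  then have "(4 * y + 1)\<^sup>2 \<le> s\<^sup>2"
    unfolding s by (simp add: power2_eq_square algebra_simps)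
  then have "4 * y + 1 \<le> s"
    by (rule power2_le_imp_le) (use s(2) in linarith)
  \<comment> \<open>The conjugate factor \<open>s + 1\<close> turns \<open>s - 1\<close> into
    \<open>16 * x\<close>, so that x can be cancelled and the bound takes the form
    \<open>4 / (s + 1)\<close>.\<close>
  then have "4 * y * (s + 1) \<le> (s - 1) * (s + 1)"
    using s by (intro mult_right_mono) auto
  also have "\<dots> = 16 * x"
    using s by (simp add: power2_eq_square algebra_simps)
  finally have "y * (s + 1) \<le> x * 4"
    by linarith
  then have "x * (bessel_gen_deriv x / bessel_gen x * (s + 1)) \<le> x * 4"
    by (simp add: y_def)
  then have "bessel_gen_deriv x / bessel_gen x * (s + 1) \<le> 4"
    using assms by (simp only: mult_le_cancel_left_pos)
  then show ?thesis
    using s unfolding s_def[symmetric] by (simp add: pos_le_divide_eq)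
qed

text \<open>Both sides vanish at 0, so it suffices to compare derivatives; after taking logarithms,
  that comparison is twice \<open>bessel_gen_deriv_le\<close>.\<close>

lemma ln_bessel_gen_le:
  assumes "x \<ge> 0"
  shows "2 * ln (bessel_gen x)
    \<le> sqrt (1 + 16 * x) - 1 - ln ((sqrt (1 + 16 * x) + 1) / 2)"
proof -
  let ?D = "\<lambda>x. sqrt (1 + 16 * x) - 1 - ln ((sqrt (1 + 16 * x) + 1) / 2)
    - 2 * ln (bessel_gen x)"
  have "?D 0 \<le> ?D x"
  proof (rule DERIV_nonneg_imp_increasing_open[OF assms])
    have deriv: "(?D has_real_derivative
        8 / (sqrt (1 + 16 * y) + 1) - 2 * (bessel_gen_deriv y / bessel_gen y)) (at y)"
      if "y \<ge> 0" for y
    proof -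
      define s where "s = sqrt (1 + 16 * y)"
      have s: "s > 0" "1 + 16 * y > 0"
        using that by (auto simp: s_def)
      have s1: "(s + 1) / 2 > 0"
        using s(1) by simp
      have sd: "((\<lambda>x. sqrt (1 + 16 * x)) has_real_derivative 8 / s) (at y)"
        unfolding s_def using s(2)
        by (auto intro!: derivative_eq_intros simp: divide_simps)
      have g: "bessel_gen y > 0"
        using bessel_gen_ge_1[OF that] by simp
      have "((\<lambda>x. (sqrt (1 + 16 * x) + 1) / 2) has_real_derivative 8 / s / 2) (at y)"
        using DERIV_cdivide[OF DERIV_add[OF sd DERIV_const[of 1]], of 2] by simp
      then have "((\<lambda>x. ln ((sqrt (1 + 16 * x) + 1) / 2)) has_real_derivative
          inverse ((s + 1) / 2) * (8 / s / 2)) (at y)"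
        using s1 unfolding s_def by (intro DERIV_chain2[OF DERIV_ln])
      moreover have "((\<lambda>x. ln (bessel_gen x)) has_real_derivative
          inverse (bessel_gen y) * bessel_gen_deriv y) (at y)"
        by (rule DERIV_chain2[OF DERIV_ln[OF g] bessel_gen_has_derivative])
      ultimately have D: "(?D has_real_derivative
          8 / s - 0 - inverse ((s + 1) / 2) * (8 / s / 2)
          - 2 * (inverse (bessel_gen y) * bessel_gen_deriv y)) (at y)"
        by (intro DERIV_diff DERIV_cmult DERIV_const sd)
      \<comment> \<open>The logarithm contributes \<open>8 / (s * (s + 1))\<close>, which reduces
        \<open>8 / s\<close> to \<open>8 / (s + 1)\<close>.\<close>
      have "8 / s - 0 - inverse ((s + 1) / 2) * (8 / s / 2) = 8 / (s + 1)"
        using s by (simp add: divide_simps)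
      moreover have "inverse (bessel_gen y) * bessel_gen_deriv y
          = bessel_gen_deriv y / bessel_gen y"
        by (simp only: divide_inverse mult.commute)
      ultimately show ?thesis
        unfolding s_def[symmetric] using D by (simp only:)
    qed
    then show "continuous_on {0..x} ?D"
      by (intro continuous_at_imp_continuous_on ballI DERIV_isCont) auto
    fix y :: real
    assume "0 < y" "y < x"
    then show "\<exists>D. (?D has_real_derivative D) (at y) \<and> 0 \<le> D"
      using deriv[of y] bessel_gen_deriv_le[of y] by (intro exI conjI) auto
  qed
  then show ?thesis
    by (simp add: bessel_gen_0)
qed

theorem theorem3p1:
  fixes t :: real
  assumes "t \<ge> 0"
  shows "(bessel_I0 t)\<^sup>2
    \<le> 2 * exp (sqrt (1 + 4 * t\<^sup>2) - 1) / (sqrt (1 + 4 * t\<^sup>2) + 1)"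
proof -
  define s where "s = sqrt (1 + 4 * t\<^sup>2)"
  have s: "s + 1 > 0"
    by (simp add: s_def add_nonneg_pos)
  have I0: "bessel_I0 t > 0"
    using bessel_gen_ge_1[of "t\<^sup>2 / 4"] by (simp add: bessel_I0_eq_bessel_gen)
  \<comment> \<open>At x = t^2 / 4 the radicand 1 + 16 x becomes 1 + 4 t^2; exponentiating then
    gives the claim.\<close>
  have "2 * ln (bessel_I0 t) \<le> s - 1 - ln ((s + 1) / 2)"
    using ln_bessel_gen_le[of "t\<^sup>2 / 4"] by (simp add: s_def bessel_I0_eq_bessel_gen)
  then have "exp (2 * ln (bessel_I0 t)) \<le> exp (s - 1 - ln ((s + 1) / 2))"
    by simp
  moreover have "exp (2 * ln (bessel_I0 t)) = (bessel_I0 t)\<^sup>2"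
    using I0 by (simp add: exp_double)
  moreover have "exp (s - 1 - ln ((s + 1) / 2)) = 2 * exp (s - 1) / (s + 1)"
    using s by (subst exp_diff) simp
  ultimately show ?thesis
    unfolding s_def by simp
qed

end
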